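(* Let $\mathscr{H}$ be a complex Hilbert space with a fixed orthonormal basis, let $\mathscr{A}\subseteq \mathbb{B}(\mathscr{H})$ be a $C^*$-algebra of operators, let $T$ be a compact Hausdorff space equipped with a Radon measure $\mu$, let $(A_t)_{t\in T}$ and $(B_t)_{t\in T}$ be fields in $\mathcal{C}(T,\mathscr{A})$ with the synchronous Hadamard property, i.e. $(A_t-A_s)\circ(B_t-B_s)\geq 0$ for all $s,t\in T$, and let $\alpha:T\to[0,+\infty)$ be a measurable function. Then $$\int_{T} \alpha(s)\, d\mu(s)\int_{T}\alpha(t)(A_t\circ B_t)\, d\mu(t)\;\geq\;\left(\int_{T}\alpha(t) A_t\, d\mu(t)\right)\circ\left(\int_{T}\alpha(s) B_s\, d\mu(s)\right).$$
   Context: $\mathbb{B}(\mathscr{H})$ is the algebra of bounded linear operators on $\mathscr{H}$. An operator $X\in\mathbb{B}(\mathscr{H})$ is positive, $X\ge 0$, if $\langle Xx,x\rangle\ge 0$ for all $x\in\mathscr{H}$; for self-adjoint operators $X,Y$, $X\ge Y$ means $X-Y\ge 0$. Given the fixed orthonormal basis $\{e_j\}$ of $\mathscr{H}$, the Hadamard product $A\circ B$ of $A,B\in\mathbb{B}(\mathscr{H})$ is defined by $\langle (A\circ B)e_i,e_j\rangle=\langle Ae_i,e_j\rangle\langle Be_i,e_j\rangle$; equivalently $A\circ B=U^*(A\otimes B)U$, where $U:\mathscr{H}\to\mathscr{H}\otimes\mathscr{H}$ is the isometry $Ue_j=e_j\otimes e_j$. $\mathcal{C}(T,\mathscr{A})$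 is the set of norm-continuous functions $T\to\mathscr{A}$, $t\mapsto A_t$. Integrals of operator-valued functions are Bochner integrals.
   Formalization: The function α is additionally assumed to be integrable with respect to μ; for a merely measurable α the integral of α may be infinite (e.g. 1/t on [0,1]), and then the left-hand side is not defined as an operator. *)

theory Defs
  imports "HOL-Analysis.Analysis"
begin

section \<open>Complex Hilbert spaces\<close>

text \<open>The inner product is linear in the first argument. The last axiom of \<open>complex_inner\<close> contains
  both positive definiteness and the fact that the norm is the one induced by the inner product.\<close>

class complex_inner = real_normed_vector +
  fixes scaleC :: "complex \<Rightarrow> 'a \<Rightarrow> 'a"  (infixr \<open>*\<^sub>C\<close> 75)
    and cinner :: "'a \<Rightarrow> 'a \<Rightarrow> complex"
  assumes scaleC_add_right: "c *\<^sub>C (x + y) = c *\<^sub>C x + c *\<^sub>C y"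
    and scaleC_add_left: "(c + d) *\<^sub>C x = c *\<^sub>C x + d *\<^sub>C x"
    and scaleC_scaleC: "c *\<^sub>C d *\<^sub>C x = (c * d) *\<^sub>C x"
    and scaleR_scaleC: "r *\<^sub>R x = complex_of_real r *\<^sub>C x"
    and cinner_commute: "cinner x y = cnj (cinner y x)"
    and cinner_add_left: "cinner (x + y) z = cinner x z + cinner y z"
    and cinner_scaleC_left: "cinner (c *\<^sub>C x) y = c * cinner x y"
    and cinner_self: "cinner x x = complex_of_real ((norm x)\<^sup>2)"

class complex_hilbert_space = complex_inner + banach

definition cspan :: "'h::complex_inner set \<Rightarrow> 'h set" where
  "cspan E = {\<Sum>e\<in>F. c e *\<^sub>C e | F c. finite F \<and> F \<subseteq> E}"

text \<open>An orthonormal basis is given as the set of its vectors.\<close>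

definition orthonormal_basis :: "'h::complex_inner set \<Rightarrow> bool" where
  "orthonormal_basis E \<longleftrightarrow>
     (\<forall>e\<in>E. \<forall>f\<in>E. cinner e f = (if e = f then 1 else 0)) \<and> closure (cspan E) = UNIV"


section \<open>Bounded operators\<close>

text \<open>The type \<open>'h \<Rightarrow>\<^sub>L 'h\<close> consists of the bounded real-linear maps with the operator norm;
  the algebra of bounded operators of the complex space is the subset of complex-linear ones.\<close>

definition bounded_operators :: "('h::complex_inner \<Rightarrow>\<^sub>L 'h) set" where
  "bounded_operators = {X. \<forall>c x. blinfun_apply X (c *\<^sub>C x) = c *\<^sub>C blinfun_apply X x}"

definition is_adjoint :: "('h::complex_inner \<Rightarrow>\<^sub>L 'h) \<Rightarrow> ('h \<Rightarrow>\<^sub>L 'h) \<Rightarrow> bool" where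
  "is_adjoint Y X \<longleftrightarrow>
     (\<forall>x y. cinner (blinfun_apply X x) y = cinner x (blinfun_apply Y y))"

definition positive_operator :: "('h::complex_inner \<Rightarrow>\<^sub>L 'h) \<Rightarrow> bool" where
  "positive_operator X \<longleftrightarrow>
     X \<in> bounded_operators \<and> (\<forall>x. cinner (blinfun_apply X x) x \<in> \<real>\<^sub>\<ge>\<^sub>0)"

text \<open>\<open>X\<close> and \<open>Y\<close> are not required to be self-adjoint here, only their difference is (being positive).\<close>

definition operator_ge :: "('h::complex_inner \<Rightarrow>\<^sub>L 'h) \<Rightarrow> ('h \<Rightarrow>\<^sub>L 'h) \<Rightarrow> bool"
    (infix \<open>\<ge>\<^sub>o\<^sub>p\<close> 50) where
  "X \<ge>\<^sub>o\<^sub>p Y \<longleftrightarrow> positive_operator (X - Y)"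

text \<open>C*-algebras of operators, not necessarily unital: norm-closed complex subalgebras of the
  bounded operators that contain adjoints.\<close>

definition cstar_algebra :: "('h::complex_inner \<Rightarrow>\<^sub>L 'h) set \<Rightarrow> bool" where
  "cstar_algebra \<A> \<longleftrightarrow>
     \<A> \<subseteq> bounded_operators \<and>
     0 \<in> \<A> \<and>
     (\<forall>X\<in>\<A>. \<forall>Y\<in>\<A>. X + Y \<in> \<A>) \<and>
     (\<forall>X\<in>\<A>. \<forall>c. \<exists>Y\<in>\<A>. \<forall>x. blinfun_apply Y x = c *\<^sub>C blinfun_apply X x) \<and>
     (\<forall>X\<in>\<A>. \<forall>Y\<in>\<A>. X o\<^sub>L Y \<in> \<A>) \<and>
     (\<forall>X\<in>\<A>. \<exists>Y\<in>\<A>. is_adjoint Y X) \<and>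
     closed \<A>"

definition hadamard ::
    "'h::complex_inner set \<Rightarrow> ('h \<Rightarrow>\<^sub>L 'h) \<Rightarrow> ('h \<Rightarrow>\<^sub>L 'h) \<Rightarrow> ('h \<Rightarrow>\<^sub>L 'h)" where
  "hadamard E A B =
     (THE C. C \<in> bounded_operators \<and>
       (\<forall>e\<in>E. \<forall>f\<in>E. cinner (blinfun_apply C e) f =
          cinner (blinfun_apply A e) f * cinner (blinfun_apply B e) f))"


section \<open>Bochner integrals in arbitrary normed spaces\<close>

text \<open>The library's \<open>has_bochner_integral\<close> and \<open>lebesgue_integral\<close> are restricted to second-countable
  spaces, which excludes operators on infinite-dimensional spaces. The definitions below are the
  library's without that sort constraint. The approximation by simple functions in the mean
  makes the integrand essentially separably valued.\<close>

definition has_bochner_int ::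
    "'t measure \<Rightarrow> ('t \<Rightarrow> 'b::real_normed_vector) \<Rightarrow> 'b \<Rightarrow> bool" where
  "has_bochner_int M f x \<longleftrightarrow>
     f \<in> borel_measurable M \<and>
     (\<exists>s. (\<forall>i. Bochner_Integration.simple_bochner_integrable M (s i)) \<and>
          (\<lambda>i. \<integral>\<^sup>+ t. ennreal (norm (f t - s i t)) \<partial>M) \<longlonglongrightarrow> 0 \<and>
          (\<lambda>i. Bochner_Integration.simple_bochner_integral M (s i)) \<longlonglongrightarrow> x)"

definition bochner_int :: "'t measure \<Rightarrow> ('t \<Rightarrow> 'b::real_normed_vector) \<Rightarrow> 'b" where
  "bochner_int M f =
     (if \<exists>x. has_bochner_int M f x then THE x. has_bochner_int M f x else 0)"

lemma has_bochner_int_iff_has_bochner_integral: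
  fixes f :: "'t \<Rightarrow> 'b::{real_normed_vector, second_countable_topology}"
  shows "has_bochner_int M f x \<longleftrightarrow> has_bochner_integral M f x"
  unfolding has_bochner_int_def has_bochner_integral.simps by auto

lemma bochner_int_eq_lebesgue_integral:
  fixes f :: "'t \<Rightarrow> 'b::{real_normed_vector, second_countable_topology}"
  shows "bochner_int M f = integral\<^sup>L M f"
  unfolding bochner_int_def lebesgue_integral_def has_bochner_int_iff_has_bochner_integral ..


section \<open>Radon measures and continuous fields of operators\<close>

definition radon_measure :: "'t::t2_space measure \<Rightarrow> bool" where
  "radon_measure M \<longleftrightarrow>
     sets M = sets borel \<and>
     (\<forall>K. compact K \<longrightarrow> emeasure M K < \<infinity>) \<and>
     (\<forall>B\<in>sets borel. emeasure M B = (INF U\<in>{U. open U \<and> B \<subseteq> U}. emeasure M U)) \<and>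
     (\<forall>U. open U \<longrightarrow> emeasure M U = (SUP K\<in>{K. compact K \<and> K \<subseteq> U}. emeasure M K))"

definition continuous_fields ::
    "('h::complex_inner \<Rightarrow>\<^sub>L 'h) set \<Rightarrow> ('t::topological_space \<Rightarrow> ('h \<Rightarrow>\<^sub>L 'h)) set" where
  "continuous_fields \<A> = {A. continuous_on UNIV A \<and> range A \<subseteq> \<A>}"

definition synchronous_hadamard ::
    "'h::complex_inner set \<Rightarrow> ('t \<Rightarrow> ('h \<Rightarrow>\<^sub>L 'h)) \<Rightarrow> ('t \<Rightarrow> ('h \<Rightarrow>\<^sub>L 'h)) \<Rightarrow> bool" where
  "synchronous_hadamard E A B \<longleftrightarrow>
     (\<forall>s t. hadamard E (A t - A s) (B t - B s) \<ge>\<^sub>o\<^sub>p 0)"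

end

theory Submission
  imports Defs
begin

text \<open>By Cauchy--Schwarz, the entrywise product of two bounded matrices is bounded (Schur), because rows and
  columns of a bounded operator are square summable with respect to an orthonormal basis. Hence
  Hadamard products exist and \<open>t \<mapsto> A t \<circ> B t\<close> is norm continuous, so all three operator integrals
  exist. Positivity only has to be tested on finite linear combinations \<open>x\<close> of basis vectors. There the
  quadratic form involves finitely many matrix entries, and these are bounded linear functionals,
  which commute with the integrals. Integrating the nonnegative number
  \<open>\<alpha> t * \<alpha> s * \<langle>((A t - A s) \<circ> (B t - B s)) x, x\<rangle>\<close> over \<open>s\<close> and then over \<open>t\<close> gives twice the difference of
  the two sides, as in the proof of Chebyshev's inequality.\<close>

section \<open>Complex inner products\<close>

lemma cinner_add_right: "cinner x (y + z) = cinner x y + cinner x z"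
  by (metis cinner_add_left cinner_commute complex_cnj_add)

lemma cinner_scaleC_right: "cinner x (c *\<^sub>C y) = cnj c * cinner x y"
  by (metis cinner_commute cinner_scaleC_left complex_cnj_mult)

lemma cinner_scaleR_left: "cinner (r *\<^sub>R x) y = r *\<^sub>R cinner x y"
  by (simp add: scaleR_scaleC cinner_scaleC_left scaleR_conv_of_real)

lemma cinner_scaleR_right: "cinner x (r *\<^sub>R y) = r *\<^sub>R cinner x y"
  by (simp add: scaleR_scaleC cinner_scaleC_right scaleR_conv_of_real)

lemma mult_cnj_cmod: "z * cnj z = (complex_of_real (cmod z))\<^sup>2"
  by (metis complex_norm_square of_real_power)

lemma cnj_mult_cmod: "cnj z * z = (complex_of_real (cmod z))\<^sup>2"
  by (metis mult_cnj_cmod mult.commute)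

text \<open>Cauchy--Schwarz by splitting \<open>x\<close> orthogonally along \<open>y\<close>:
  Pythagoras shows that the component along \<open>y\<close> is no longer than
  \<open>x\<close>.\<close>

lemma cmod_cinner_le: "cmod (cinner x y) \<le> norm x * norm (y::'h::complex_inner)"
proof (cases "y = 0")
  case True
  have "cinner x 0 = 0"
    using cinner_scaleR_right[of x 0 0] by simp
  with True show ?thesis by simp
next
  case False
  \<comment> \<open>The coefficient of the orthogonal projection of \<open>x\<close> onto the line
    through \<open>y\<close>, so that the remainder \<open>z\<close> is orthogonal to
    \<open>y\<close>.\<close>
  define c where "c = cinner x y / (norm y)\<^sup>2"
  define z where "z = x + (- c) *\<^sub>C y"
  have zy: "cinner z y = 0"
    using False by (simp add: z_def c_def cinner_add_left cinner_scaleC_left cinner_self)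
  have "complex_of_real ((norm x)\<^sup>2) = cinner (z + c *\<^sub>C y) (z + c *\<^sub>C y)"
    by (simp add: z_def cinner_self add.assoc flip: scaleC_add_left)
       (metis (no_types, lifting) add.right_neutral scaleR_scaleC scaleR_zero_left of_real_0)
  also have "\<dots> = cinner z z + c * cnj c * cinner y y"
    using zy cinner_commute[of y z]
    by (simp add: cinner_add_left cinner_add_right cinner_scaleC_left cinner_scaleC_right)
  also have "\<dots> = complex_of_real ((norm z)\<^sup>2 + (cmod c)\<^sup>2 * (norm y)\<^sup>2)"
    by (simp add: cinner_self mult_cnj_cmod)
  finally have "(norm x)\<^sup>2 = (norm z)\<^sup>2 + (cmod c)\<^sup>2 * (norm y)\<^sup>2"
    using of_real_eq_iff by blast
  then have "(cmod c * norm y)\<^sup>2 \<le> (norm x)\<^sup>2"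
    by (simp add: power_mult_distrib)
  then have "cmod c * norm y \<le> norm x"
    using power2_le_imp_le norm_ge_zero by blast
  moreover have "cmod c * norm y = cmod (cinner x y) / norm y"
    using False by (simp add: c_def norm_divide norm_power) (simp add: power2_eq_square)
  ultimately have "cmod (cinner x y) / norm y \<le> norm x"
    by simp
  with False show ?thesis
    by (simp add: pos_divide_le_eq)
qed

text \<open>Conjugate linearity in the second argument is invisible to real scalars. Over the reals
  the inner product is therefore bilinear, and Cauchy--Schwarz bounds it with constant 1; sums,
  differences, limits and continuity follow from this.\<close>

interpretation cinner: bounded_bilinear "cinner :: 'h::complex_inner \<Rightarrow> 'h \<Rightarrow> complex"
  by unfold_locales
     (auto simp: cinner_add_left cinner_add_right cinner_scaleR_left cinner_scaleR_right
        intro!: exI[of _ 1] cmod_cinner_le)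

section \<open>Complex-linear operators\<close>

lemma blinfun_apply_scaleC:
  "X \<in> bounded_operators \<Longrightarrow> blinfun_apply X (c *\<^sub>C x) = c *\<^sub>C blinfun_apply X x"
  by (simp add: bounded_operators_def)

lemma bounded_operators_diff:
  assumes "X \<in> bounded_operators" "Y \<in> bounded_operators"
  shows "X - Y \<in> (bounded_operators :: ('h::complex_inner \<Rightarrow>\<^sub>L 'h) set)"
proof -
  have "c *\<^sub>C (x - y) = c *\<^sub>C x - c *\<^sub>C y" for c and x y :: 'h
    using scaleC_add_right[of c "x - y" y] by simp
  then show ?thesis
    using assms by (simp add: bounded_operators_def blinfun.diff_left)
qed

lemma bounded_operators_scaleR:
  assumes "X \<in> bounded_operators"
  shows "r *\<^sub>R X \<in> (bounded_operators :: ('h::complex_inner \<Rightarrow>\<^sub>L 'h) set)"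
  using assms
  by (simp add: bounded_operators_def blinfun.scaleR_left scaleR_scaleC scaleC_scaleC mult.commute)

section \<open>Orthonormal bases and the existence of Hadamard products\<close>

locale complex_onb =
  fixes E :: "'h::complex_hilbert_space set"
  assumes onb: "orthonormal_basis E"
begin

lemma cinner_basis: "e \<in> E \<Longrightarrow> f \<in> E \<Longrightarrow> cinner e f = (if e = f then 1 else 0)"
  using onb unfolding orthonormal_basis_def by blast

lemma norm_basis: "e \<in> E \<Longrightarrow> norm e = 1"
  using cinner_basis[of e e] cinner_self[of e]
  by (metis norm_ge_zero of_real_eq_1_iff power2_eq_iff_nonneg power_one zero_le_one)

lemma closure_cspan: "closure (cspan E) = UNIV"
  using onb unfolding orthonormal_basis_def by blast

text \<open>Density of the span reduces a closed condition to finite linear combinations.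
  Uniqueness, boundedness and positivity are all extended to the whole space in this way.\<close>

lemma closed_cspan_induct:
  assumes "closed {x. P x}" "\<And>x. x \<in> cspan E \<Longrightarrow> P x"
  shows "P x"
proof -
  have "closure (cspan E) \<subseteq> {x. P x}"
    using assms by (intro closure_minimal) auto
  then show ?thesis
    using closure_cspan by auto
qed

text \<open>The difference \<open>x - y\<close> is orthogonal to the basis, hence to the closure of
  its span, hence to itself.\<close>

lemma eqI_basis:
  assumes "\<And>e. e \<in> E \<Longrightarrow> cinner x e = cinner y e"
  shows "x = (y::'h)"
proof -
  have "cinner z (x - y) = 0" for z
  proof (rule closed_cspan_induct[where P = "\<lambda>z. cinner z (x - y) = 0"])
    show "closed {z. cinner z (x - y) = 0}"
      by (intro closed_Collect_eq continuous_intros cinner.continuous_on)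
    fix z assume "z \<in> cspan E"
    then obtain F c where F: "finite F" "F \<subseteq> E" and z: "z = (\<Sum>e\<in>F. c e *\<^sub>C e)"
      unfolding cspan_def by auto
    have "cinner e (x - y) = 0" if "e \<in> F" for e
      using assms[of e] that F cinner_commute[of e "x - y"] by (auto simp: cinner.diff_left)
    then show "cinner z (x - y) = 0"
      by (simp add: z cinner.sum_left cinner_scaleC_left)
  qed
  from this[of "x - y"] show ?thesis
    by (simp add: cinner_self)
qed

section \<open>Finite orthonormal sums, Bessel's inequality and the Riesz--Fischer theorem\<close>

lemma cinner_sum_basis:
  assumes "finite F" "F \<subseteq> E" "f \<in> E"
  shows "cinner (\<Sum>e\<in>F. c e *\<^sub>C e) f = (if f \<in> F then c f else 0)"
proof -
  have "cinner (\<Sum>e\<in>F. c e *\<^sub>C e) f = (\<Sum>e\<in>F. if e = f then c e else 0)"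
    unfolding cinner.sum_left
    using assms by (intro sum.cong) (auto simp: cinner_scaleC_left cinner_basis)
  then show ?thesis
    using assms by simp
qed

lemma cinner_sum_basis_sum:
  assumes "finite F" "F \<subseteq> E"
  shows "cinner x (\<Sum>e\<in>F. c e *\<^sub>C e) = (\<Sum>e\<in>F. cnj (c e) * cinner x e)"
  by (simp add: cinner.sum_right cinner_scaleC_right)

lemma norm_sum_basis:
  assumes "finite F" "F \<subseteq> E"
  shows "(norm (\<Sum>e\<in>F. c e *\<^sub>C e))\<^sup>2 = (\<Sum>e\<in>F. (cmod (c e))\<^sup>2)"
proof -
  have "complex_of_real ((norm (\<Sum>e\<in>F. c e *\<^sub>C e))\<^sup>2)
      = (\<Sum>f\<in>F. cnj (c f) * cinner (\<Sum>e\<in>F. c e *\<^sub>C e) f)"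
    unfolding cinner_self[symmetric] using cinner_sum_basis_sum[OF assms] .
  also have "\<dots> = (\<Sum>f\<in>F. cnj (c f) * c f)"
    using assms by (intro sum.cong refl) (simp add: cinner_sum_basis subsetD)
  also have "\<dots> = complex_of_real (\<Sum>e\<in>F. (cmod (c e))\<^sup>2)"
    by (simp add: cnj_mult_cmod)
  finally show ?thesis
    using of_real_eq_iff by blast
qed

text \<open>The vector \<open>y\<close> is the projection of \<open>x\<close> onto the span of
  \<open>F\<close>. Since the inner product of \<open>x\<close> and \<open>y\<close> is the squared
  norm of \<open>y\<close>, Cauchy--Schwarz gives that \<open>y\<close> is no longer than
  \<open>x\<close>.\<close>

lemma bessel:
  assumes "finite F" "F \<subseteq> E"
  shows "(\<Sum>e\<in>F. (cmod (cinner x e))\<^sup>2) \<le> (norm x)\<^sup>2"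
proof -
  define y where "y = (\<Sum>e\<in>F. cinner x e *\<^sub>C e)"
  have ny: "(norm y)\<^sup>2 = (\<Sum>e\<in>F. (cmod (cinner x e))\<^sup>2)"
    unfolding y_def by (rule norm_sum_basis[OF assms])
  have "cinner x y = (\<Sum>e\<in>F. cnj (cinner x e) * cinner x e)"
    unfolding y_def by (rule cinner_sum_basis_sum[OF assms])
  also have "\<dots> = complex_of_real ((norm y)\<^sup>2)"
    by (simp add: ny cnj_mult_cmod)
  finally have "(norm y)\<^sup>2 = cmod (cinner x y)"
    by (metis norm_of_real abs_of_nonneg zero_le_power2)
  with cmod_cinner_le[of x y] have "norm y * norm y \<le> norm x * norm y"
    by (simp add: power2_eq_square)
  then have "norm y \<le> norm x"
    by (cases "y = 0") auto
  then show ?thesis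
    by (simp add: power_mono flip: ny)
qed

text \<open>The basis may be uncountable, so the series is summed along the net of finite subsets.
  By Pythagoras its partial sums are Cauchy because the sums of squares converge, and completeness
  supplies the limit. This lemma is the only source of new vectors below: a vector is built from its
  coordinates.\<close>

lemma riesz_fischer:
  assumes K: "\<And>F. finite F \<Longrightarrow> F \<subseteq> E \<Longrightarrow> (\<Sum>e\<in>F. (cmod (c e))\<^sup>2) \<le> K"
  shows "\<exists>x::'h. (norm x)\<^sup>2 \<le> K \<and> (\<forall>e\<in>E. cinner x e = c e)"
proof -
  have "(\<lambda>e. (cmod (c e))\<^sup>2) summable_on E"
    using K by (intro nonneg_bdd_above_summable_on bdd_aboveI[of _ K]) auto
  then obtain S where S: "((\<lambda>e. (cmod (c e))\<^sup>2) has_sum S) E"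
    unfolding summable_on_def by auto
  have "\<exists>P. eventually P (finite_subsets_at_top E) \<and>
      (\<forall>F G. P F \<and> P G \<longrightarrow> dist (\<Sum>e\<in>F. c e *\<^sub>C e) (\<Sum>e\<in>G. c e *\<^sub>C e) < \<epsilon>)" if "\<epsilon> > 0" for \<epsilon>
  proof -
    \<comment> \<open>With this tolerance, the sums of squares over \<open>F\<close> and
      \<open>F0\<close> differ by less than the square of \<epsilon>/2. The corresponding vectors
      are then within \<epsilon>/2 of each other, and any two late partial sums are compared through
      \<open>F0\<close>.\<close>
    have "\<forall>\<^sub>F F in finite_subsets_at_top E. dist (\<Sum>e\<in>F. (cmod (c e))\<^sup>2) S < (\<epsilon>/2)\<^sup>2 / 2"
      using S that unfolding has_sum_def by (intro tendstoD) auto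
    then obtain F0 where F0: "finite F0" "F0 \<subseteq> E"
      and d: "\<And>F. finite F \<Longrightarrow> F0 \<subseteq> F \<Longrightarrow> F \<subseteq> E \<Longrightarrow>
        dist (\<Sum>e\<in>F. (cmod (c e))\<^sup>2) S < (\<epsilon>/2)\<^sup>2 / 2"
      unfolding eventually_finite_subsets_at_top by metis
    have near: "dist (\<Sum>e\<in>F. c e *\<^sub>C e) (\<Sum>e\<in>F0. c e *\<^sub>C e) < \<epsilon>/2"
      if F: "finite F" "F0 \<subseteq> F" "F \<subseteq> E" for F
    proof -
      have "(dist (\<Sum>e\<in>F. c e *\<^sub>C e) (\<Sum>e\<in>F0. c e *\<^sub>C e))\<^sup>2 = (norm (\<Sum>e\<in>F - F0. c e *\<^sub>C e))\<^sup>2"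
        using F by (simp add: dist_norm sum_diff)
      also have "\<dots> = (\<Sum>e\<in>F - F0. (cmod (c e))\<^sup>2)"
        using F by (intro norm_sum_basis) auto
      also have "\<dots> = (\<Sum>e\<in>F. (cmod (c e))\<^sup>2) - (\<Sum>e\<in>F0. (cmod (c e))\<^sup>2)"
        using F by (simp add: sum_diff)
      also have "\<dots> < (\<epsilon>/2)\<^sup>2"
        using d[OF F] d[OF F0(1) order_refl F0(2)] unfolding dist_real_def by argo
      finally show ?thesis
        using that \<open>\<epsilon> > 0\<close> power2_less_imp_less[of _ "\<epsilon>/2"] by simp
    qed
    show ?thesis
    proof (intro exI conjI allI impI)
      show "\<forall>\<^sub>F F in finite_subsets_at_top E. finite F \<and> F0 \<subseteq> F \<and> F \<subseteq> E"
        using F0 unfolding eventually_finite_subsets_at_top by blast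
      show "dist (\<Sum>e\<in>F. c e *\<^sub>C e) (\<Sum>e\<in>G. c e *\<^sub>C e) < \<epsilon>"
        if "(finite F \<and> F0 \<subseteq> F \<and> F \<subseteq> E) \<and> finite G \<and> F0 \<subseteq> G \<and> G \<subseteq> E" for F G
        using that by (intro dist_triangle_half_l[OF near near]) auto
    qed
  qed
  then have "cauchy_filter (filtermap (sum (\<lambda>e. c e *\<^sub>C e)) (finite_subsets_at_top E))"
    by (simp add: cauchy_filter_metric_filtermap)
  moreover have "complete (UNIV::'h set)"
    by (meson Cauchy_convergent UNIV_I complete_def convergent_def)
  ultimately obtain x where "(sum (\<lambda>e. c e *\<^sub>C e) \<longlongrightarrow> x) (finite_subsets_at_top E)"
    using cauchy_filter_complete_converges[of "filtermap (sum (\<lambda>e. c e *\<^sub>C e)) (finite_subsets_at_top E)" UNIV]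
    by (auto simp: filterlim_def filtermap_bot_iff)
  then have x: "((\<lambda>e. c e *\<^sub>C e) has_sum x) E"
    unfolding has_sum_def .
  have "cinner x f = c f" if f: "f \<in> E" for f
  proof (rule has_sum_unique)
    show "((\<lambda>e. cinner (c e *\<^sub>C e) f) has_sum cinner x f) E"
      using cinner.bounded_linear_left x by (rule has_sum_bounded_linear)
    show "((\<lambda>e. cinner (c e *\<^sub>C e) f) has_sum c f) E"
      \<comment> \<open>By orthonormality only the term at \<open>f\<close> survives.\<close>
      using f by (intro has_sum_finite_neutralI[of "{f}"]) (auto simp: cinner_scaleC_left cinner_basis)
  qed
  moreover have "(norm x)\<^sup>2 \<le> K"
  proof (rule tendsto_le)
    show "((\<lambda>F. (norm (\<Sum>e\<in>F. c e *\<^sub>C e))\<^sup>2) \<longlongrightarrow> (norm x)\<^sup>2) (finite_subsets_at_top E)"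
      using x unfolding has_sum_def by (intro tendsto_intros)
    show "((\<lambda>_. K) \<longlongrightarrow> K) (finite_subsets_at_top E)"
      by (rule tendsto_const)
    show "\<forall>\<^sub>F F in finite_subsets_at_top E. (norm (\<Sum>e\<in>F. c e *\<^sub>C e))\<^sup>2 \<le> K"
      by (intro eventually_finite_subsets_at_top_weakI) (simp add: norm_sum_basis K)
  qed simp
  ultimately show ?thesis by blast
qed

section \<open>Matrix entries of bounded operators and Schur's bound\<close>

text \<open>Entries fix the values on the basis, complex linearity those on the span, and continuity
  all others. This gives uniqueness in the description \<open>hadamard\<close> and reduces
  identities between Hadamard products to identities between numbers.\<close>

lemma bounded_operators_eqI:
  assumes X: "X \<in> bounded_operators" and Y: "Y \<in> bounded_operators"
    and eq: "\<And>e f. e \<in> E \<Longrightarrow> f \<in> E \<Longrightarrow>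
      cinner (blinfun_apply X e) f = cinner (blinfun_apply Y e) f"
  shows "X = (Y :: 'h \<Rightarrow>\<^sub>L 'h)"
proof (rule blinfun_eqI, rule closed_cspan_induct[where P = "\<lambda>x. blinfun_apply X x = blinfun_apply Y x"])
  show "closed {x. blinfun_apply X x = blinfun_apply Y x}"
    by (intro closed_Collect_eq continuous_intros)
  fix x assume "x \<in> cspan E"
  then obtain F c where F: "finite F" "F \<subseteq> E" and x: "x = (\<Sum>e\<in>F. c e *\<^sub>C e)"
    unfolding cspan_def by auto
  have "blinfun_apply X e = blinfun_apply Y e" if "e \<in> F" for e
    using that F eq by (intro eqI_basis) auto
  then show "blinfun_apply X x = blinfun_apply Y x"
    by (simp add: x blinfun.sum_right blinfun_apply_scaleC X Y)
qed

text \<open>For the adjoint this would be Bessel's inequality. Here \<open>X\<close> is instead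
  tested on the vector \<open>v\<close> whose coefficients are the conjugated row: the inner product
  of \<open>X v\<close> with \<open>f\<close> is the squared norm of \<open>v\<close>, but is at
  most \<open>norm X * norm v\<close>.\<close>

lemma sum_row_le:
  assumes X: "X \<in> bounded_operators" and F: "finite F" "F \<subseteq> E" and f: "f \<in> E"
  shows "(\<Sum>e\<in>F. (cmod (cinner (blinfun_apply X e) f))\<^sup>2) \<le> (norm (X :: 'h \<Rightarrow>\<^sub>L 'h))\<^sup>2"
proof -
  define v where "v = (\<Sum>e\<in>F. cnj (cinner (blinfun_apply X e) f) *\<^sub>C e)"
  have nv: "(norm v)\<^sup>2 = (\<Sum>e\<in>F. (cmod (cinner (blinfun_apply X e) f))\<^sup>2)"
    unfolding v_def by (simp add: norm_sum_basis[OF F])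
  have "cinner (blinfun_apply X v) f = complex_of_real ((norm v)\<^sup>2)"
    unfolding nv by (simp add: cnj_mult_cmod v_def blinfun.sum_right blinfun_apply_scaleC X
        cinner.sum_left cinner_scaleC_left)
  then have "(norm v)\<^sup>2 = cmod (cinner (blinfun_apply X v) f)"
    by (metis norm_of_real abs_of_nonneg zero_le_power2)
  also have "\<dots> \<le> norm (blinfun_apply X v)"
    using cmod_cinner_le[of _ f] by (simp add: norm_basis[OF f])
  also have "\<dots> \<le> norm X * norm v"
    by (rule norm_blinfun)
  finally have "norm v \<le> norm X"
    by (cases "v = 0") (auto simp: power2_eq_square)
  then show ?thesis
    by (simp add: power_mono flip: nv)
qed

text \<open>Cauchy--Schwarz in \<open>e\<close> separates, for fixed \<open>f\<close>, a row of
  \<open>B\<close> from the weighted entries of \<open>A\<close>. Complex linearity enters through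
  the rows of \<open>B\<close> (\<open>sum_row_le\<close>); the columns of \<open>A\<close> are
  coordinates of the vectors \<open>A e\<close> and fall under Bessel's inequality.\<close>

lemma schur_bound:
  fixes A B :: "'h \<Rightarrow>\<^sub>L 'h"
  assumes B: "B \<in> bounded_operators" and F: "finite F" "F \<subseteq> E" and G: "finite G" "G \<subseteq> E"
  shows "(\<Sum>f\<in>G. (cmod (\<Sum>e\<in>F. c e * (cinner (blinfun_apply A e) f * cinner (blinfun_apply B e) f)))\<^sup>2)
    \<le> (norm A * norm B)\<^sup>2 * (\<Sum>e\<in>F. (cmod (c e))\<^sup>2)"
proof -
  let ?a = "\<lambda>e f. cmod (cinner (blinfun_apply A e) f)"
  let ?b = "\<lambda>e f. cmod (cinner (blinfun_apply B e) f)"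
  have "(cmod (\<Sum>e\<in>F. c e * (cinner (blinfun_apply A e) f * cinner (blinfun_apply B e) f)))\<^sup>2
      \<le> (\<Sum>e\<in>F. (cmod (c e) * ?a e f)\<^sup>2) * (norm B)\<^sup>2" if f: "f \<in> G" for f
  proof -
    have "(cmod (\<Sum>e\<in>F. c e * (cinner (blinfun_apply A e) f * cinner (blinfun_apply B e) f)))\<^sup>2
        \<le> (\<Sum>e\<in>F. (cmod (c e) * ?a e f) * ?b e f)\<^sup>2"
      by (intro power_mono order_trans[OF norm_sum]) (auto simp: norm_mult mult.assoc)
    also have "\<dots> \<le> (\<Sum>e\<in>F. (cmod (c e) * ?a e f)\<^sup>2) * (\<Sum>e\<in>F. (?b e f)\<^sup>2)"
      by (rule Cauchy_Schwarz_ineq_sum)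
    also have "\<dots> \<le> (\<Sum>e\<in>F. (cmod (c e) * ?a e f)\<^sup>2) * (norm B)\<^sup>2"
      using f G F B by (intro mult_left_mono sum_row_le sum_nonneg) auto
    finally show ?thesis .
  qed
  then have "(\<Sum>f\<in>G. (cmod (\<Sum>e\<in>F. c e * (cinner (blinfun_apply A e) f * cinner (blinfun_apply B e) f)))\<^sup>2)
      \<le> (\<Sum>f\<in>G. (\<Sum>e\<in>F. (cmod (c e) * ?a e f)\<^sup>2) * (norm B)\<^sup>2)"
    by (rule sum_mono)
  \<comment> \<open>Interchanging the sums lets the inner one run down a single column of
    \<open>A\<close>.\<close>
  also have "\<dots> = (norm B)\<^sup>2 * (\<Sum>e\<in>F. (cmod (c e))\<^sup>2 * (\<Sum>f\<in>G. (?a e f)\<^sup>2))"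
    unfolding sum_distrib_right[symmetric] by (subst sum.swap) (simp add: power_mult_distrib sum_distrib_left mult.commute)
  also have "\<dots> \<le> (norm B)\<^sup>2 * (\<Sum>e\<in>F. (cmod (c e))\<^sup>2 * (norm A)\<^sup>2)"
  proof (intro mult_left_mono sum_mono)
    fix e assume "e \<in> F"
    then have ne: "norm e = 1"
      using F norm_basis by auto
    have "(\<Sum>f\<in>G. (?a e f)\<^sup>2) \<le> (norm (blinfun_apply A e))\<^sup>2"
      by (rule bessel[OF G])
    also have "\<dots> \<le> (norm A)\<^sup>2"
      using norm_blinfun[of A e] by (intro power_mono) (auto simp: ne)
    finally show "(\<Sum>f\<in>G. (?a e f)\<^sup>2) \<le> (norm A)\<^sup>2" .
  qed auto
  also have "\<dots> = (norm A * norm B)\<^sup>2 * (\<Sum>e\<in>F. (cmod (c e))\<^sup>2)"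
    by (simp add: sum_distrib_left power_mult_distrib mult_ac)
  finally show ?thesis .
qed

text \<open>The operator is built by two applications of \<open>riesz_fischer\<close>. The first
  turns each row of the product matrix into a vector \<open>w f\<close>, so that the inner product
  of \<open>x\<close> with \<open>w f\<close> is the intended coordinate of \<open>C x\<close> at
  \<open>f\<close>. The second assembles these coordinates into \<open>C x\<close>;
  \<open>schur_bound\<close> provides their square summability and the norm bound.\<close>

lemma hadamard_exists:
  fixes A B :: "'h \<Rightarrow>\<^sub>L 'h"
  assumes B: "B \<in> bounded_operators"
  shows "\<exists>C\<in>bounded_operators. norm C \<le> norm A * norm B \<and>
    (\<forall>e\<in>E. \<forall>f\<in>E. cinner (blinfun_apply C e) f =
      cinner (blinfun_apply A e) f * cinner (blinfun_apply B e) f)"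
proof -
  define m where "m e f = cinner (blinfun_apply A e) f * cinner (blinfun_apply B e) f" for e f
  define K where "K = norm A * norm B"
  have "K \<ge> 0"
    by (simp add: K_def)
  \<comment> \<open>The entries are conjugated because \<open>w f\<close> will stand in the second,
    conjugate-linear argument. Square summability holds since the entries of \<open>A\<close> are at
    most \<open>norm A\<close> and the rows of \<open>B\<close> are square summable.\<close>
  have "\<exists>w. \<forall>e\<in>E. cinner w e = cnj (m e f)" if f: "f \<in> E" for f
  proof -
    have "(\<Sum>e\<in>F. (cmod (cnj (m e f)))\<^sup>2) \<le> (norm A)\<^sup>2 * (norm B)\<^sup>2" if F: "finite F" "F \<subseteq> E" for F
    proof -
      have "(cmod (cnj (m e f)))\<^sup>2 \<le> (norm A)\<^sup>2 * (cmod (cinner (blinfun_apply B e) f))\<^sup>2"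
        if "e \<in> F" for e
      proof -
        have "norm e = 1" "norm f = 1"
          using F \<open>e \<in> F\<close> f norm_basis by auto
        then have "cmod (cinner (blinfun_apply A e) f) \<le> norm A"
          using cmod_cinner_le[of "blinfun_apply A e" f] norm_blinfun[of A e] by simp
        then show ?thesis
          by (simp add: m_def norm_mult power_mult_distrib mult_right_mono power_mono)
      qed
      then have "(\<Sum>e\<in>F. (cmod (cnj (m e f)))\<^sup>2)
          \<le> (norm A)\<^sup>2 * (\<Sum>e\<in>F. (cmod (cinner (blinfun_apply B e) f))\<^sup>2)"
        unfolding sum_distrib_left by (rule sum_mono)
      also have "\<dots> \<le> (norm A)\<^sup>2 * (norm B)\<^sup>2"
        using sum_row_le[OF B F f] by (intro mult_left_mono) auto
      finally show ?thesis .
    qed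
    then have "\<exists>w. (norm w)\<^sup>2 \<le> (norm A)\<^sup>2 * (norm B)\<^sup>2 \<and> (\<forall>e\<in>E. cinner w e = cnj (m e f))"
      by (rule riesz_fischer)
    then show ?thesis
      by auto
  qed
  then obtain w where w: "\<And>e f. e \<in> E \<Longrightarrow> f \<in> E \<Longrightarrow> cinner (w f) e = cnj (m e f)"
    by metis
  then have w': "cinner e (w f) = m e f" if "e \<in> E" "f \<in> E" for e f
    using that by (metis cinner_commute complex_cnj_cnj)
  \<comment> \<open>For finitely many coordinates both sides depend continuously on
    \<open>x\<close>, so the estimate passes from the span, where it is \<open>schur_bound\<close>,
    to every \<open>x\<close>.\<close>
  have "(\<Sum>f\<in>G. (cmod (cinner x (w f)))\<^sup>2) \<le> (K * norm x)\<^sup>2"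
    if G: "finite G" "G \<subseteq> E" for G x
  proof (rule closed_cspan_induct[where P = "\<lambda>x. (\<Sum>f\<in>G. (cmod (cinner x (w f)))\<^sup>2) \<le> (K * norm x)\<^sup>2"])
    show "closed {x. (\<Sum>f\<in>G. (cmod (cinner x (w f)))\<^sup>2) \<le> (K * norm x)\<^sup>2}"
      by (intro closed_Collect_le continuous_intros cinner.continuous_on)
    fix x assume "x \<in> cspan E"
    then obtain F c where F: "finite F" "F \<subseteq> E" and x: "x = (\<Sum>e\<in>F. c e *\<^sub>C e)"
      unfolding cspan_def by auto
    have "cinner x (w f) = (\<Sum>e\<in>F. c e * m e f)" if "f \<in> G" for f
      using that F G by (auto simp: x cinner.sum_left cinner_scaleC_left intro!: sum.cong w' arg_cong2[where f="(*)"])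
    then show "(\<Sum>f\<in>G. (cmod (cinner x (w f)))\<^sup>2) \<le> (K * norm x)\<^sup>2"
      using schur_bound[OF B F G, of c A] by (simp add: m_def K_def power_mult_distrib x norm_sum_basis F)
  qed
  then have "\<exists>y. (norm y)\<^sup>2 \<le> (K * norm x)\<^sup>2 \<and> (\<forall>f\<in>E. cinner y f = cinner x (w f))" for x
    by (rule riesz_fischer)
  then obtain C where nC: "\<And>x. (norm (C x))\<^sup>2 \<le> (K * norm x)\<^sup>2"
    and C: "\<And>x f. f \<in> E \<Longrightarrow> cinner (C x) f = cinner x (w f)"
    by metis
  have nC': "norm (C x) \<le> norm x * K" for x
    using power2_le_imp_le[OF nC[of x]] \<open>K \<ge> 0\<close> by (simp add: mult.commute)
  \<comment> \<open>Linearity needs no formula for \<open>C x\<close>: both sides of each equation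
    have the same coordinates.\<close>
  have "bounded_linear C"
  proof (rule bounded_linear_intro)
    show "C (x + y) = C x + C y" for x y
      by (rule eqI_basis) (simp add: C cinner_add_left)
    show "C (r *\<^sub>R x) = r *\<^sub>R C x" for r x
      by (rule eqI_basis) (simp add: C cinner_scaleR_left)
  qed (rule nC')
  then have CC: "blinfun_apply (Blinfun C) = C"
    by (rule bounded_linear_Blinfun_apply)
  have "C (c *\<^sub>C x) = c *\<^sub>C C x" for c x
    by (rule eqI_basis) (simp add: C cinner_scaleC_left)
  then have "Blinfun C \<in> bounded_operators"
    by (simp add: bounded_operators_def CC)
  moreover have "norm (Blinfun C) \<le> K"
    by (rule norm_blinfun_bound) (use \<open>K \<ge> 0\<close> nC' in \<open>auto simp: CC mult.commute\<close>)
  ultimately show ?thesis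
    by (intro bexI[of _ "Blinfun C"]) (auto simp: CC C w' m_def K_def)
qed

section \<open>Calculus of Hadamard products\<close>

text \<open>The definite description is resolved once. Everything later relies only on complex
  linearity, the entries and the submultiplicative norm bound.\<close>

lemma
  fixes A B :: "'h \<Rightarrow>\<^sub>L 'h"
  assumes B: "B \<in> bounded_operators"
  shows hadamard_in_bounded_operators: "hadamard E A B \<in> bounded_operators"
    and hadamard_apply: "e \<in> E \<Longrightarrow> f \<in> E \<Longrightarrow> cinner (blinfun_apply (hadamard E A B) e) f
      = cinner (blinfun_apply A e) f * cinner (blinfun_apply B e) f"
    and norm_hadamard: "norm (hadamard E A B) \<le> norm A * norm B"
proof -
  obtain C where C: "C \<in> bounded_operators" "norm C \<le> norm A * norm B"
    "\<forall>e\<in>E. \<forall>f\<in>E. cinner (blinfun_apply C e) f = cinner (blinfun_apply A e) f * cinner (blinfun_apply B e) f"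
    using hadamard_exists[OF B, of A] by blast
  have eq: "hadamard E A B = C"
    unfolding hadamard_def
  proof (rule the_equality)
    fix D assume D: "D \<in> bounded_operators \<and> (\<forall>e\<in>E. \<forall>f\<in>E. cinner (blinfun_apply D e) f =
      cinner (blinfun_apply A e) f * cinner (blinfun_apply B e) f)"
    show "D = C"
      by (rule bounded_operators_eqI) (use C D in auto)
  qed (use C in blast)
  show "hadamard E A B \<in> bounded_operators" "norm (hadamard E A B) \<le> norm A * norm B"
    using C eq by auto
  show "cinner (blinfun_apply (hadamard E A B) e) f
      = cinner (blinfun_apply A e) f * cinner (blinfun_apply B e) f" if "e \<in> E" "f \<in> E"
    using that C eq by auto
qed

lemma hadamard_diff_left:
  assumes "B \<in> bounded_operators"
  shows "hadamard E (A - A') B = hadamard E A B - hadamard E A' B"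
  using assms
  by (intro bounded_operators_eqI bounded_operators_diff hadamard_in_bounded_operators)
     (simp_all add: hadamard_apply blinfun.diff_left cinner.diff_left left_diff_distrib)

lemma hadamard_diff_right:
  assumes "B \<in> bounded_operators" "B' \<in> bounded_operators"
  shows "hadamard E A (B - B') = hadamard E A B - hadamard E A B'"
  using assms
  by (intro bounded_operators_eqI bounded_operators_diff hadamard_in_bounded_operators)
     (simp_all add: hadamard_apply blinfun.diff_left cinner.diff_left right_diff_distrib bounded_operators_diff)

text \<open>As for any bounded product, the increment is split by changing one factor at a time, and
  each piece is estimated by \<open>norm_hadamard\<close>.\<close>

lemma continuous_on_hadamard:
  assumes A: "continuous_on S A" and B: "continuous_on S B"
    and Bb: "\<And>t. t \<in> S \<Longrightarrow> B t \<in> bounded_operators"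
  shows "continuous_on S (\<lambda>t. hadamard E (A t) (B t))"
  unfolding continuous_on_def
proof
  fix s assume s: "s \<in> S"
  have At: "(A \<longlongrightarrow> A s) (at s within S)" and Bt: "(B \<longlongrightarrow> B s) (at s within S)"
    using A B s by (auto simp: continuous_on_def)
  have "((\<lambda>t. norm (A t - A s) * norm (B t) + norm (A s) * norm (B t - B s))
      \<longlongrightarrow> norm (A s - A s) * norm (B s) + norm (A s) * norm (B s - B s)) (at s within S)"
    by (intro tendsto_intros At Bt)
  then have lim: "((\<lambda>t. norm (A t - A s) * norm (B t) + norm (A s) * norm (B t - B s)) \<longlongrightarrow> 0) (at s within S)"
    by simp
  have le: "norm (hadamard E (A t) (B t) - hadamard E (A s) (B s))
      \<le> norm (A t - A s) * norm (B t) + norm (A s) * norm (B t - B s)" if t: "t \<in> S" for t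
  proof -
    have "hadamard E (A t) (B t) - hadamard E (A s) (B s)
        = hadamard E (A t - A s) (B t) + hadamard E (A s) (B t - B s)"
      using Bb s t by (simp add: hadamard_diff_left hadamard_diff_right)
    then show ?thesis
      using Bb s t by (simp add: norm_triangle_mono norm_hadamard bounded_operators_diff)
  qed
  have "((\<lambda>t. hadamard E (A t) (B t) - hadamard E (A s) (B s)) \<longlongrightarrow> 0) (at s within S)"
    by (rule Lim_null_comparison[OF _ lim]) (use le in \<open>auto simp: eventually_at_filter\<close>)
  then show "((\<lambda>t. hadamard E (A t) (B t)) \<longlongrightarrow> hadamard E (A s) (B s)) (at s within S)"
    by (rule LIM_zero_cancel)
qed

end

section \<open>Bochner integrals\<close>

text \<open>In a nonseparable space, sums and products of two Borel functions can fail to be Borel.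
  If one of them is simple, its finitely many values can be frozen one by one and the resulting
  measurable functions glued.\<close>

lemma measurable_simple_function_compose:
  assumes s: "simple_function M s" and f: "\<And>c. (\<lambda>x. f c x) \<in> measurable M N"
  shows "(\<lambda>x. f (s x) x) \<in> measurable M N"
proof (rule measurable_compose_countable'[where I = "s ` space M"])
  show "countable (s ` space M)"
    using s by (simp add: simple_function_def countable_finite)
  show "s \<in> measurable M (count_space (s ` space M))"
    using s by (auto simp: measurable_count_space_eq2 simple_function_def)
qed (rule f)

lemma borel_measurable_norm_diff_simple:
  fixes f s :: "'t \<Rightarrow> 'b::real_normed_vector"
  assumes f: "f \<in> borel_measurable M" and s: "simple_function M s"
  shows "(\<lambda>x. norm (f x - s x)) \<in> borel_measurable M"
proof (rule measurable_simple_function_compose[OF s, where f = "\<lambda>c x. norm (f x - c)"])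
  show "(\<lambda>x. norm (f x - c)) \<in> borel_measurable M" for c
    using f by (rule measurable_compose) (intro borel_measurable_continuous_onI continuous_intros)
qed

lemma simple_bochner_integrable_simple_function:
  "Bochner_Integration.simple_bochner_integrable M s \<Longrightarrow> simple_function M s"
  by (erule simple_bochner_integrable.cases)

text \<open>Distances of integrals are controlled by distances in the mean to a common function
  \<open>f\<close>. This serves both the uniqueness of the integral and the Cauchy property of
  approximating integrals.\<close>

lemma simple_bochner_integral_norm_diff_le:
  fixes f s t :: "'t \<Rightarrow> 'b::real_normed_vector"
  assumes f: "f \<in> borel_measurable M"
    and s: "Bochner_Integration.simple_bochner_integrable M s"
    and t: "Bochner_Integration.simple_bochner_integrable M t"
  shows "ennreal (norm (Bochner_Integration.simple_bochner_integral M s -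
      Bochner_Integration.simple_bochner_integral M t))
    \<le> (\<integral>\<^sup>+x. ennreal (norm (f x - s x)) \<partial>M) + (\<integral>\<^sup>+x. ennreal (norm (f x - t x)) \<partial>M)"
proof -
  note [measurable] = borel_measurable_norm_diff_simple[OF f simple_bochner_integrable_simple_function[OF s]]
    borel_measurable_norm_diff_simple[OF f simple_bochner_integrable_simple_function[OF t]]
  have st: "Bochner_Integration.simple_bochner_integrable M (\<lambda>x. s x - t x)"
    "Bochner_Integration.simple_bochner_integrable M (\<lambda>x. norm (s x - t x))"
    using s t by (auto intro: simple_bochner_integrable_compose2[of "(-)"]
        simple_bochner_integrable_compose2[of "\<lambda>x y. norm (x - y)"])
  have "ennreal (norm (Bochner_Integration.simple_bochner_integral M s -
      Bochner_Integration.simple_bochner_integral M t)) \<le> (\<integral>\<^sup>+x. ennreal (norm (s x - t x)) \<partial>M)"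
    unfolding simple_bochner_integral_diff[OF s t, symmetric]
    using simple_bochner_integral_norm_bound[OF st(1)]
    by (subst simple_bochner_integral_eq_nn_integral[OF st(2), symmetric]) (auto intro: ennreal_leI)
  also have "\<dots> \<le> (\<integral>\<^sup>+x. ennreal (norm (f x - s x)) + ennreal (norm (f x - t x)) \<partial>M)"
  proof (rule nn_integral_mono)
    fix x
    have "norm (s x - t x) \<le> norm (f x - s x) + norm (f x - t x)"
      using norm_triangle_ineq4[of "f x - t x" "f x - s x"] by simp
    then show "ennreal (norm (s x - t x)) \<le> ennreal (norm (f x - s x)) + ennreal (norm (f x - t x))"
      by (simp flip: ennreal_plus)
  qed
  also have "\<dots> = (\<integral>\<^sup>+x. ennreal (norm (f x - s x)) \<partial>M) + (\<integral>\<^sup>+x. ennreal (norm (f x - t x)) \<partial>M)"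
    by (rule nn_integral_add) measurable
  finally show ?thesis .
qed

text \<open>For any two approximating sequences, the distance of their integrals is squeezed to zero
  by the preceding estimate.\<close>

lemma has_bochner_int_unique:
  fixes f :: "'t \<Rightarrow> 'b::real_normed_vector"
  assumes "has_bochner_int M f x" "has_bochner_int M f y"
  shows "x = y"
proof -
  obtain s where f: "f \<in> borel_measurable M"
    and s: "\<And>i. Bochner_Integration.simple_bochner_integrable M (s i)"
    and s0: "(\<lambda>i. \<integral>\<^sup>+ t. ennreal (norm (f t - s i t)) \<partial>M) \<longlonglongrightarrow> 0"
    and sx: "(\<lambda>i. Bochner_Integration.simple_bochner_integral M (s i)) \<longlonglongrightarrow> x"
    using assms(1) unfolding has_bochner_int_def by auto
  obtain r where r: "\<And>i. Bochner_Integration.simple_bochner_integrable M (r i)"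
    and r0: "(\<lambda>i. \<integral>\<^sup>+ t. ennreal (norm (f t - r i t)) \<partial>M) \<longlonglongrightarrow> 0"
    and ry: "(\<lambda>i. Bochner_Integration.simple_bochner_integral M (r i)) \<longlonglongrightarrow> y"
    using assms(2) unfolding has_bochner_int_def by auto
  let ?d = "\<lambda>i. Bochner_Integration.simple_bochner_integral M (s i) -
    Bochner_Integration.simple_bochner_integral M (r i)"
  have "(\<lambda>i. ennreal (norm (?d i))) \<longlonglongrightarrow> 0"
  proof (rule tendsto_sandwich[OF _ _ tendsto_const])
    show "(\<lambda>i. (\<integral>\<^sup>+ t. ennreal (norm (f t - s i t)) \<partial>M) + (\<integral>\<^sup>+ t. ennreal (norm (f t - r i t)) \<partial>M)) \<longlonglongrightarrow> 0"
      using tendsto_add[OF s0 r0] by simp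
  qed (auto intro!: always_eventually simple_bochner_integral_norm_diff_le f s r)
  moreover have "(\<lambda>i. ennreal (norm (?d i))) \<longlonglongrightarrow> ennreal (norm (x - y))"
    by (intro tendsto_intros tendsto_ennrealI sx ry)
  ultimately have "ennreal (norm (x - y)) = 0"
    using LIMSEQ_unique by blast
  then show ?thesis by simp
qed

lemma has_bochner_int_bochner_int:
  "has_bochner_int M f x \<Longrightarrow> has_bochner_int M f (bochner_int M f)"
  unfolding bochner_int_def by (auto intro: theI has_bochner_int_unique)

text \<open>In a Banach space the integrals of a sequence that approximates in the mean are
  automatically Cauchy, so integrability only requires exhibiting such a sequence.\<close>

lemma has_bochner_int_complete:
  fixes f :: "'t \<Rightarrow> 'b::banach"
  assumes f: "f \<in> borel_measurable M"
    and s: "\<And>i. Bochner_Integration.simple_bochner_integrable M (s i)"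
    and lim: "(\<lambda>i. \<integral>\<^sup>+ t. ennreal (norm (f t - s i t)) \<partial>M) \<longlonglongrightarrow> 0"
  shows "\<exists>x. has_bochner_int M f x"
proof -
  let ?I = "\<lambda>i. Bochner_Integration.simple_bochner_integral M (s i)"
  have "Cauchy ?I"
  proof (rule metric_CauchyI)
    fix e :: real assume "e > 0"
    then have "\<forall>\<^sub>F i in sequentially. (\<integral>\<^sup>+ t. ennreal (norm (f t - s i t)) \<partial>M) < ennreal (e/2)"
      using lim by (intro order_tendstoD(2)) auto
    then obtain N where N: "\<And>i. i \<ge> N \<Longrightarrow> (\<integral>\<^sup>+ t. ennreal (norm (f t - s i t)) \<partial>M) < ennreal (e/2)"
      unfolding eventually_sequentially by auto
    have "dist (?I m) (?I n) < e" if "m \<ge> N" "n \<ge> N" for m n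
    proof -
      have "ennreal (dist (?I m) (?I n)) < ennreal (e/2) + ennreal (e/2)"
        unfolding dist_norm
        using simple_bochner_integral_norm_diff_le[OF f s s] add_strict_mono[OF N[OF that(1)] N[OF that(2)]]
        by (rule order.strict_trans1)
      also have "\<dots> = ennreal e"
        using \<open>e > 0\<close> by (simp flip: ennreal_plus)
      finally show ?thesis
        using \<open>e > 0\<close> by (simp add: ennreal_less_iff)
    qed
    then show "\<exists>N. \<forall>m\<ge>N. \<forall>n\<ge>N. dist (?I m) (?I n) < e"
      by blast
  qed
  then obtain x where "?I \<longlonglongrightarrow> x"
    using Cauchy_convergent convergent_def by blast
  then show ?thesis
    using assms unfolding has_bochner_int_def by blast
qed

text \<open>Applying \<open>T\<close> to an approximating sequence for \<open>f\<close> gives one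
  for the composition. Taking matrix entries for \<open>T\<close>, this carries every question about
  operator integrals over to ordinary complex integrals.\<close>

lemma has_bochner_int_bounded_linear:
  fixes f :: "'t \<Rightarrow> 'b::real_normed_vector"
    and T :: "'b \<Rightarrow> 'c::{real_normed_vector, second_countable_topology}"
  assumes T: "bounded_linear T" and "has_bochner_int M f x"
  shows "has_bochner_integral M (\<lambda>t. T (f t)) (T x)"
proof -
  interpret T: bounded_linear T by fact
  obtain s where f: "f \<in> borel_measurable M"
    and s: "\<And>i. Bochner_Integration.simple_bochner_integrable M (s i)"
    and s0: "(\<lambda>i. \<integral>\<^sup>+ t. ennreal (norm (f t - s i t)) \<partial>M) \<longlonglongrightarrow> 0"
    and sx: "(\<lambda>i. Bochner_Integration.simple_bochner_integral M (s i)) \<longlonglongrightarrow> x"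
    using assms(2) unfolding has_bochner_int_def by auto
  obtain K where K: "K > 0" "\<And>y. norm (T y) \<le> norm y * K"
    using T.pos_bounded by auto
  show ?thesis
  proof (rule has_bochner_integral.intros[where s = "\<lambda>i t. T (s i t)"])
    show "(\<lambda>t. T (f t)) \<in> borel_measurable M"
      using f by (rule measurable_compose)
        (intro borel_measurable_continuous_onI T.continuous_on continuous_on_id)
    show "Bochner_Integration.simple_bochner_integrable M (\<lambda>t. T (s i t))" for i
      using s by (auto intro: simple_bochner_integrable_compose2[of "\<lambda>x y. T x"] T.zero)
    show "(\<lambda>i. Bochner_Integration.simple_bochner_integral M (\<lambda>t. T (s i t))) \<longlonglongrightarrow> T x"
      unfolding simple_bochner_integral_linear[OF T.linear_axioms s] by (rule T.tendsto[OF sx])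
    show "(\<lambda>i. \<integral>\<^sup>+ t. ennreal (norm (T (f t) - T (s i t))) \<partial>M) \<longlonglongrightarrow> 0"
    proof (rule tendsto_sandwich[OF _ _ tendsto_const])
      show "(\<lambda>i. ennreal K * (\<integral>\<^sup>+ t. ennreal (norm (f t - s i t)) \<partial>M)) \<longlonglongrightarrow> 0"
        using ennreal_tendsto_cmult[OF _ s0, of "ennreal K"] by simp
      have "(\<integral>\<^sup>+ t. ennreal (norm (T (f t) - T (s i t))) \<partial>M)
          \<le> ennreal K * (\<integral>\<^sup>+ t. ennreal (norm (f t - s i t)) \<partial>M)" for i
      proof -
        have "(\<integral>\<^sup>+ t. ennreal (norm (T (f t) - T (s i t))) \<partial>M)
            \<le> (\<integral>\<^sup>+ t. ennreal K * ennreal (norm (f t - s i t)) \<partial>M)"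
          using K by (intro nn_integral_mono)
            (simp add: ennreal_mult'[symmetric] mult.commute ennreal_leI flip: T.diff)
        also have "\<dots> = ennreal K * (\<integral>\<^sup>+ t. ennreal (norm (f t - s i t)) \<partial>M)"
          using borel_measurable_norm_diff_simple[OF f simple_bochner_integrable_simple_function[OF s]]
          by (intro nn_integral_cmult) simp
        finally show ?thesis .
      qed
      then show "\<forall>\<^sub>F i in sequentially. (\<integral>\<^sup>+ t. ennreal (norm (T (f t) - T (s i t))) \<partial>M)
          \<le> ennreal K * (\<integral>\<^sup>+ t. ennreal (norm (f t - s i t)) \<partial>M)"
        by simp
    qed simp
  qed
qed

section \<open>Integrability of weighted continuous fields on a compact space\<close>

text \<open>Each point is assigned a centre whose ball contains its value. In the induction the new
  centre takes precedence and the earlier selection handles the rest; the default 0 for no centres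
  is harmless, as the condition is then vacuous.\<close>

lemma simple_function_select_ball:
  fixes A :: "'t \<Rightarrow> 'b::real_normed_vector"
  assumes "finite k" and A: "A \<in> borel_measurable M"
  shows "\<exists>s. simple_function M s \<and> (\<forall>t. A t \<in> (\<Union>x\<in>k. ball x \<epsilon>) \<longrightarrow> A t \<in> ball (s t) \<epsilon>)"
  using assms(1)
proof induction
  case empty
  show ?case by (intro exI[of _ "\<lambda>_. 0"]) auto
next
  case (insert x k)
  then obtain s where s: "simple_function M s" "\<forall>t. A t \<in> (\<Union>x\<in>k. ball x \<epsilon>) \<longrightarrow> A t \<in> ball (s t) \<epsilon>"
    by blast
  have "{t \<in> space M. A t \<in> ball x \<epsilon>} \<in> sets M"
    using measurable_sets[OF A, of "ball x \<epsilon>"] by (simp add: vimage_def Int_def conj_commute)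
  then have "simple_function M (\<lambda>t. if A t \<in> ball x \<epsilon> then x else s t)"
    using s(1) by (intro simple_function_If) auto
  then show ?case
    using s(2) by (intro exI[of _ "\<lambda>t. if A t \<in> ball x \<epsilon> then x else s t"]) auto
qed

text \<open>The compact range of \<open>A\<close> is totally bounded, so \<open>A\<close> is a
  uniform limit of simple functions \<open>S n\<close>, in place of any separability of the operator
  space. Multiplying these by simple functions \<open>a n\<close> that approximate \<alpha> in the
  mean approximates the product in the mean.\<close>

lemma has_bochner_int_scaleR_continuous:
  fixes A :: "'t::topological_space \<Rightarrow> 'b::banach"
  assumes comp: "compact (UNIV :: 't set)" and M: "sets M = sets borel"
    and A: "continuous_on UNIV A" and \<alpha>: "integrable M \<alpha>"
  shows "has_bochner_int M (\<lambda>t. \<alpha> t *\<^sub>R A t) (bochner_int M (\<lambda>t. \<alpha> t *\<^sub>R A t))"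
proof -
  have K: "compact (range A)"
    using A comp by (rule compact_continuous_image)
  then obtain C where C: "\<And>t. norm (A t) \<le> C"
    using compact_imp_bounded bounded_iff by (metis rangeI)
  have "0 \<le> C"
    using C[of undefined] norm_ge_zero order_trans by blast
  have Am: "A \<in> borel_measurable M"
    using borel_measurable_continuous_onI[OF A] measurable_cong_sets[OF M refl] by blast
  have "\<exists>s. simple_function M s \<and> (\<forall>t. norm (A t - s t) \<le> 1 / real (Suc n))" for n
  proof -
    obtain k where "finite k" and k: "range A \<subseteq> (\<Union>x\<in>k. ball x (1 / real (Suc n)))"
      using K unfolding compact_eq_totally_bounded by (meson of_nat_0_less_iff zero_less_Suc zero_less_divide_1_iff)
    obtain s where "simple_function M s"
      and s: "\<forall>t. A t \<in> (\<Union>x\<in>k. ball x (1 / real (Suc n))) \<longrightarrow> A t \<in> ball (s t) (1 / real (Suc n))"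
      using simple_function_select_ball[OF \<open>finite k\<close> Am] by blast
    moreover have "norm (A t - s t) \<le> 1 / real (Suc n)" for t
    proof -
      have "A t \<in> ball (s t) (1 / real (Suc n))"
        using s k by blast
      then show ?thesis
        by (simp add: dist_norm norm_minus_commute)
    qed
    ultimately show ?thesis by blast
  qed
  then obtain S where S: "\<And>n. simple_function M (S n)"
    and AS: "\<And>n t. norm (A t - S n t) \<le> 1 / real (Suc n)"
    by metis
  \<comment> \<open>Uniform closeness at most 1 turns the bound on \<open>A\<close> into one for all
    \<open>S n\<close> that does not depend on \<open>n\<close>.\<close>
  have SC: "norm (S n t) \<le> C + 1" for n t
  proof -
    have "norm (S n t) \<le> norm (A t) + norm (A t - S n t)"
      by (metis norm_triangle_sub norm_minus_commute)
    moreover have "1 / real (Suc n) \<le> 1"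
      by simp
    ultimately show ?thesis
      using C[of t] AS[of t n] by linarith
  qed
  have \<alpha>m: "\<alpha> \<in> borel_measurable M"
    using \<alpha> by (rule borel_measurable_integrable)
  from \<alpha> obtain I where "has_bochner_integral M \<alpha> I"
    unfolding integrable.simps by blast
  then obtain a where a: "\<And>n. Bochner_Integration.simple_bochner_integrable M (a n)"
    and a0: "(\<lambda>n. \<integral>\<^sup>+t. ennreal (norm (\<alpha> t - a n t)) \<partial>M) \<longlonglongrightarrow> 0"
    by (rule has_bochner_integral.cases) blast
  have "\<exists>x. has_bochner_int M (\<lambda>t. \<alpha> t *\<^sub>R A t) x"
  proof (rule has_bochner_int_complete[where s = "\<lambda>n t. a n t *\<^sub>R S n t"])
    show "(\<lambda>t. \<alpha> t *\<^sub>R A t) \<in> borel_measurable M"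
    \<comment> \<open>Measurability of the product is obtained as a pointwise limit, each term being
      measurable because \<open>S n\<close> is simple.\<close>
    proof (rule borel_measurable_LIMSEQ_metric[where f = "\<lambda>n t. \<alpha> t *\<^sub>R S n t"])
      show "(\<lambda>t. \<alpha> t *\<^sub>R S n t) \<in> borel_measurable M" for n
      proof (rule measurable_simple_function_compose[OF S, where f = "\<lambda>c t. \<alpha> t *\<^sub>R c"])
        show "(\<lambda>t. \<alpha> t *\<^sub>R c) \<in> borel_measurable M" for c :: 'b
          using \<alpha>m by (rule measurable_compose)
            (intro borel_measurable_continuous_onI continuous_intros)
      qed
      show "(\<lambda>n. \<alpha> t *\<^sub>R S n t) \<longlonglongrightarrow> \<alpha> t *\<^sub>R A t" for t
      proof -
        have "(\<lambda>n. A t - S n t) \<longlonglongrightarrow> 0"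
          by (rule Lim_null_comparison[OF _ LIMSEQ_Suc[OF lim_1_over_n]]) (use AS in simp)
        then have "(\<lambda>n. A t - (A t - S n t)) \<longlonglongrightarrow> A t - 0"
          by (intro tendsto_intros)
        then have "(\<lambda>n. S n t) \<longlonglongrightarrow> A t"
          by simp
        then show ?thesis
          by (intro tendsto_intros)
      qed
    qed
    show "Bochner_Integration.simple_bochner_integrable M (\<lambda>t. a n t *\<^sub>R S n t)" for n
    proof
      have an: "simple_function M (a n)"
        by (rule simple_bochner_integrable_simple_function[OF a])
      show "simple_function M (\<lambda>t. a n t *\<^sub>R S n t)"
        using an S by (rule simple_function_compose2)
      have "a n \<in> borel_measurable M"
        using an by (rule borel_measurable_simple_function)
      then have "emeasure M {t \<in> space M. a n t *\<^sub>R S n t \<noteq> 0} \<le> emeasure M {t \<in> space M. a n t \<noteq> 0}"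
        by (intro emeasure_mono) auto
      also have "\<dots> < \<infinity>"
        using a[of n] by (auto simp: simple_bochner_integrable.simps less_top)
      finally show "emeasure M {t \<in> space M. a n t *\<^sub>R S n t \<noteq> 0} \<noteq> \<infinity>"
        by simp
    qed
    show "(\<lambda>n. \<integral>\<^sup>+ t. ennreal (norm (\<alpha> t *\<^sub>R A t - a n t *\<^sub>R S n t)) \<partial>M) \<longlonglongrightarrow> 0"
    proof (rule tendsto_sandwich[OF _ _ tendsto_const])
      let ?N = "\<integral>t. norm (\<alpha> t) \<partial>M"
      \<comment> \<open>The two terms come from replacing \<alpha> by \<open>a n\<close> against the
        bounded \<open>S n\<close>, and \<open>A\<close> by \<open>S n\<close> against the
        integrable \<alpha>.\<close>
      let ?u = "\<lambda>n. ennreal (C + 1) * (\<integral>\<^sup>+t. ennreal (norm (\<alpha> t - a n t)) \<partial>M) + ennreal (1 / real (Suc n) * ?N)"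
      have "?u \<longlonglongrightarrow> ennreal (C + 1) * 0 + ennreal (0 * ?N)"
        by (intro tendsto_add ennreal_tendsto_cmult a0 tendsto_ennrealI tendsto_mult tendsto_const
            LIMSEQ_Suc[OF lim_1_over_n]) simp
      then show "?u \<longlonglongrightarrow> 0"
        by simp
      have "(\<integral>\<^sup>+ t. ennreal (norm (\<alpha> t *\<^sub>R A t - a n t *\<^sub>R S n t)) \<partial>M) \<le> ?u n" for n
      proof -
        have "norm (\<alpha> t *\<^sub>R A t - a n t *\<^sub>R S n t)
            \<le> (C + 1) * norm (\<alpha> t - a n t) + 1 / real (Suc n) * norm (\<alpha> t)" for t
        proof -
          have "\<alpha> t *\<^sub>R A t - a n t *\<^sub>R S n t = (\<alpha> t - a n t) *\<^sub>R S n t + \<alpha> t *\<^sub>R (A t - S n t)"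
            by (simp add: algebra_simps)
          also have "norm \<dots> \<le> norm (\<alpha> t - a n t) * norm (S n t) + norm (\<alpha> t) * norm (A t - S n t)"
            by (rule norm_triangle_mono) simp_all
          also have "\<dots> \<le> norm (\<alpha> t - a n t) * (C + 1) + norm (\<alpha> t) * (1 / real (Suc n))"
            by (intro add_mono mult_left_mono SC AS) simp_all
          finally show ?thesis
            by (simp add: mult.commute)
        qed
        then have "(\<integral>\<^sup>+ t. ennreal (norm (\<alpha> t *\<^sub>R A t - a n t *\<^sub>R S n t)) \<partial>M)
            \<le> (\<integral>\<^sup>+ t. ennreal (C + 1) * ennreal (norm (\<alpha> t - a n t))
                + ennreal (1 / real (Suc n) * norm (\<alpha> t)) \<partial>M)"
          using \<open>0 \<le> C\<close> by (intro nn_integral_mono)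
            (simp add: ennreal_mult'[symmetric] ennreal_leI flip: ennreal_plus)
        also have "\<dots> = (\<integral>\<^sup>+ t. ennreal (C + 1) * ennreal (norm (\<alpha> t - a n t)) \<partial>M)
            + (\<integral>\<^sup>+ t. ennreal (1 / real (Suc n) * norm (\<alpha> t)) \<partial>M)"
          using \<alpha>m borel_measurable_norm_diff_simple[OF \<alpha>m simple_bochner_integrable_simple_function[OF a]]
          by (intro nn_integral_add) simp_all
        also have "\<dots> = ?u n"
        proof (intro arg_cong2[where f = "(+)"])
          show "(\<integral>\<^sup>+ t. ennreal (C + 1) * ennreal (norm (\<alpha> t - a n t)) \<partial>M)
              = ennreal (C + 1) * (\<integral>\<^sup>+ t. ennreal (norm (\<alpha> t - a n t)) \<partial>M)"
            using borel_measurable_norm_diff_simple[OF \<alpha>m simple_bochner_integrable_simple_function[OF a]]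
            by (intro nn_integral_cmult) simp
          show "(\<integral>\<^sup>+ t. ennreal (1 / real (Suc n) * norm (\<alpha> t)) \<partial>M) = ennreal (1 / real (Suc n) * ?N)"
            using \<alpha> by (subst nn_integral_eq_integral) auto
        qed
        finally show ?thesis .
      qed
      then show "\<forall>\<^sub>F n in sequentially. (\<integral>\<^sup>+ t. ennreal (norm (\<alpha> t *\<^sub>R A t - a n t *\<^sub>R S n t)) \<partial>M) \<le> ?u n"
        by simp
    qed simp
  qed
  then show ?thesis
    using has_bochner_int_bochner_int by blast
qed

section \<open>The integral inequality\<close>

lemma has_bochner_integral_nonneg_Reals:
  fixes f :: "'t \<Rightarrow> complex"
  assumes f: "has_bochner_integral M f z" and nn: "\<And>t. f t \<in> \<real>\<^sub>\<ge>\<^sub>0"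
  shows "z \<in> \<real>\<^sub>\<ge>\<^sub>0"
proof -
  have "Re z = (\<integral>t. Re (f t) \<partial>M)" "Im z = (\<integral>t. Im (f t) \<partial>M)"
    using has_bochner_integral_bounded_linear[OF bounded_linear_Re f]
      has_bochner_integral_bounded_linear[OF bounded_linear_Im f]
    by (simp_all add: has_bochner_integral_integral_eq)
  then show ?thesis
    using nn by (simp add: complex_nonneg_Reals_iff)
qed

text \<open>The two integrations, over \<open>s\<close> and then over \<open>t\<close>, are each carried out by linearity, so Fubini's
  theorem is not needed.\<close>

lemma synchronous_integral_inequality:
  fixes \<alpha> :: "'t \<Rightarrow> real" and a b :: "'j \<Rightarrow> 't \<Rightarrow> complex"
  assumes I: "has_bochner_integral M \<alpha> I" and nn: "\<And>t. 0 \<le> \<alpha> t"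
    and a: "\<And>j. j \<in> J \<Longrightarrow> has_bochner_integral M (\<lambda>t. \<alpha> t *\<^sub>R a j t) (A j)"
    and b: "\<And>j. j \<in> J \<Longrightarrow> has_bochner_integral M (\<lambda>t. \<alpha> t *\<^sub>R b j t) (B j)"
    and ab: "\<And>j. j \<in> J \<Longrightarrow> has_bochner_integral M (\<lambda>t. \<alpha> t *\<^sub>R (a j t * b j t)) (P j)"
    and sync: "\<And>s t. (\<Sum>j\<in>J. w j * ((a j t - a j s) * (b j t - b j s))) \<in> \<real>\<^sub>\<ge>\<^sub>0"
  shows "(\<Sum>j\<in>J. w j * (I *\<^sub>R P j - A j * B j)) \<in> \<real>\<^sub>\<ge>\<^sub>0"
proof -
  have I': "has_bochner_integral M (\<lambda>t. complex_of_real (\<alpha> t)) (complex_of_real I)"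
    by (rule has_bochner_integral_bounded_linear[OF bounded_linear_of_real I])
  \<comment> \<open>This is the integral over \<open>s\<close> of the weighted synchronous sum with
    \<open>t\<close> fixed. Expanding the product of differences gives its four terms.\<close>
  define R where "R t = (\<Sum>j\<in>J. w j * (a j t * b j t * I - a j t * B j - b j t * A j + P j))" for t
  have R: "R t \<in> \<real>\<^sub>\<ge>\<^sub>0" for t
  proof (rule has_bochner_integral_nonneg_Reals)
    have "has_bochner_integral M (\<lambda>s. \<Sum>j\<in>J. w j * (a j t * b j t * complex_of_real (\<alpha> s)
        - a j t * (\<alpha> s *\<^sub>R b j s) - b j t * (\<alpha> s *\<^sub>R a j s) + \<alpha> s *\<^sub>R (a j s * b j s))) (R t)"
      unfolding R_def
      by (intro has_bochner_integral_sum has_bochner_integral_mult_right has_bochner_integral_add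
          has_bochner_integral_diff I' a b ab)
    also have "(\<lambda>s. \<Sum>j\<in>J. w j * (a j t * b j t * complex_of_real (\<alpha> s)
        - a j t * (\<alpha> s *\<^sub>R b j s) - b j t * (\<alpha> s *\<^sub>R a j s) + \<alpha> s *\<^sub>R (a j s * b j s)))
      = (\<lambda>s. \<alpha> s *\<^sub>R (\<Sum>j\<in>J. w j * ((a j t - a j s) * (b j t - b j s))))"
      unfolding scaleR_sum_right by (intro ext sum.cong) (auto simp: scaleR_conv_of_real algebra_simps)
    finally show "has_bochner_integral M (\<lambda>s. \<alpha> s *\<^sub>R (\<Sum>j\<in>J. w j * ((a j t - a j s) * (b j t - b j s)))) (R t)" .
    show "\<alpha> s *\<^sub>R (\<Sum>j\<in>J. w j * ((a j t - a j s) * (b j t - b j s))) \<in> \<real>\<^sub>\<ge>\<^sub>0" for s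
      using sync nn by (simp add: scaleR_conv_of_real)
  qed
  \<comment> \<open>Under integration over \<open>t\<close> the first and last terms of
    \<open>R\<close> both give \<open>I * P j\<close>, and the two mixed terms both give
    \<open>A j * B j\<close>; hence the factor 2.\<close>
  have "2 * (\<Sum>j\<in>J. w j * (I *\<^sub>R P j - A j * B j)) \<in> \<real>\<^sub>\<ge>\<^sub>0"
  proof (rule has_bochner_integral_nonneg_Reals)
    have "has_bochner_integral M (\<lambda>t. \<Sum>j\<in>J. w j * (I * (\<alpha> t *\<^sub>R (a j t * b j t))
        - B j * (\<alpha> t *\<^sub>R a j t) - A j * (\<alpha> t *\<^sub>R b j t) + P j * complex_of_real (\<alpha> t)))
      (\<Sum>j\<in>J. w j * (I * P j - B j * A j - A j * B j + P j * I))"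
      by (intro has_bochner_integral_sum has_bochner_integral_mult_right has_bochner_integral_add
          has_bochner_integral_diff I' a b ab)
    also have "(\<lambda>t. \<Sum>j\<in>J. w j * (I * (\<alpha> t *\<^sub>R (a j t * b j t))
        - B j * (\<alpha> t *\<^sub>R a j t) - A j * (\<alpha> t *\<^sub>R b j t) + P j * complex_of_real (\<alpha> t)))
      = (\<lambda>t. \<alpha> t *\<^sub>R R t)"
      unfolding R_def scaleR_sum_right
      by (intro ext sum.cong) (auto simp: scaleR_conv_of_real algebra_simps)
    also have "(\<Sum>j\<in>J. w j * (I * P j - B j * A j - A j * B j + P j * I))
      = 2 * (\<Sum>j\<in>J. w j * (I *\<^sub>R P j - A j * B j))"
      unfolding sum_distrib_left by (intro sum.cong) (auto simp: scaleR_conv_of_real algebra_simps)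
    finally show "has_bochner_integral M (\<lambda>t. \<alpha> t *\<^sub>R R t) (2 * (\<Sum>j\<in>J. w j * (I *\<^sub>R P j - A j * B j)))" .
    show "\<alpha> t *\<^sub>R R t \<in> \<real>\<^sub>\<ge>\<^sub>0" for t
      using R nn by (simp add: scaleR_conv_of_real)
  qed
  then show ?thesis
    by (simp add: complex_nonneg_Reals_iff)
qed

section \<open>From matrix entries back to operators\<close>

lemma bounded_linear_matrix_entry: "bounded_linear (\<lambda>X. cinner (blinfun_apply X x) y)"
  by (rule bounded_linear_compose[OF cinner.bounded_linear_left blinfun.bounded_linear_left])

text \<open>Integrals are formed in the space of real-linear bounded maps, so their complex
  linearity has to be recovered from that of the integrand.\<close>

lemma has_bochner_int_bounded_operators:
  fixes X :: "'h::complex_inner \<Rightarrow>\<^sub>L 'h"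
  assumes f: "has_bochner_int M f X" and bo: "\<And>t. f t \<in> bounded_operators"
  shows "X \<in> bounded_operators"
proof -
  have "blinfun_apply X (c *\<^sub>C x) = c *\<^sub>C blinfun_apply X x" for c x
  proof -
    \<comment> \<open>The defect of linearity is itself used as the test vector: the scalar
      integrals then show that \<open>y\<close> is orthogonal to itself.\<close>
    define y where "y = blinfun_apply X (c *\<^sub>C x) - c *\<^sub>C blinfun_apply X x"
    have "has_bochner_integral M (\<lambda>t. cinner (blinfun_apply (f t) (c *\<^sub>C x)) y)
        (cinner (blinfun_apply X (c *\<^sub>C x)) y)"
      by (rule has_bochner_int_bounded_linear[OF bounded_linear_matrix_entry f])
    moreover have "has_bochner_integral M (\<lambda>t. c * cinner (blinfun_apply (f t) x) y)
        (c * cinner (blinfun_apply X x) y)"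
      by (intro has_bochner_integral_mult_right has_bochner_int_bounded_linear[OF bounded_linear_matrix_entry f])
    then have "has_bochner_integral M (\<lambda>t. cinner (blinfun_apply (f t) (c *\<^sub>C x)) y)
        (c * cinner (blinfun_apply X x) y)"
      by (simp add: blinfun_apply_scaleC[OF bo] cinner_scaleC_left)
    ultimately have "cinner (blinfun_apply X (c *\<^sub>C x)) y = c * cinner (blinfun_apply X x) y"
      by (rule has_bochner_integral_eq)
    then have "cinner y y = 0"
      unfolding y_def by (simp add: cinner.diff_left cinner_scaleC_left)
    then show ?thesis
      by (simp add: cinner_self y_def)
  qed
  then show ?thesis
    by (simp add: bounded_operators_def)
qed

text \<open>Pairs of basis vectors serve as a single index, which matches the weighted sum over
  \<open>J\<close> in \<open>synchronous_integral_inequality\<close>.\<close>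

lemma cinner_apply_sum:
  assumes "X \<in> bounded_operators"
  shows "cinner (blinfun_apply X (\<Sum>e\<in>F. c e *\<^sub>C e)) (\<Sum>e\<in>F. c e *\<^sub>C e)
    = (\<Sum>j\<in>F \<times> F. c (fst j) * cnj (c (snd j)) * cinner (blinfun_apply X (fst j)) (snd j))"
proof -
  have "cinner (blinfun_apply X (\<Sum>e\<in>F. c e *\<^sub>C e)) (\<Sum>f\<in>F. c f *\<^sub>C f)
      = (\<Sum>e\<in>F. \<Sum>f\<in>F. c e * cnj (c f) * cinner (blinfun_apply X e) f)"
    unfolding blinfun.sum_right cinner.sum_left unfolding cinner.sum_right
    by (simp add: blinfun_apply_scaleC[OF assms] cinner_scaleC_left cinner_scaleC_right mult_ac)
  then show ?thesis
    by (simp add: sum.cartesian_product case_prod_unfold)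
qed

text \<open>The quadratic form is continuous and the nonnegative reals are closed in the complex
  plane, so vectors in the span suffice.\<close>

lemma (in complex_onb) positive_operatorI:
  assumes X: "X \<in> bounded_operators"
    and pos: "\<And>F c. finite F \<Longrightarrow> F \<subseteq> E \<Longrightarrow>
      (\<Sum>j\<in>F \<times> F. c (fst j) * cnj (c (snd j)) * cinner (blinfun_apply X (fst j)) (snd j)) \<in> \<real>\<^sub>\<ge>\<^sub>0"
  shows "positive_operator X"
  unfolding positive_operator_def
proof (intro conjI allI X)
  fix x :: 'h
  show "cinner (blinfun_apply X x) x \<in> \<real>\<^sub>\<ge>\<^sub>0"
  proof (rule closed_cspan_induct[where P = "\<lambda>x. cinner (blinfun_apply X x) x \<in> \<real>\<^sub>\<ge>\<^sub>0"])
    show "closed {x. cinner (blinfun_apply X x) x \<in> \<real>\<^sub>\<ge>\<^sub>0}"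
      unfolding complex_nonneg_Reals_iff
      by (intro closed_Collect_conj closed_Collect_le closed_Collect_eq continuous_intros
          cinner.continuous_on blinfun.continuous_on)
    fix x assume "x \<in> cspan E"
    then show "cinner (blinfun_apply X x) x \<in> \<real>\<^sub>\<ge>\<^sub>0"
      unfolding cspan_def using pos by (auto simp: cinner_apply_sum[OF X])
  qed
qed

theorem theorem2p2:
  fixes E :: "'h::complex_hilbert_space set"
    and \<A> :: "('h \<Rightarrow>\<^sub>L 'h) set"
    and \<mu> :: "'t::t2_space measure"
    and A B :: "'t \<Rightarrow> ('h \<Rightarrow>\<^sub>L 'h)"
    and \<alpha> :: "'t \<Rightarrow> real"
  assumes "orthonormal_basis E"
    and "cstar_algebra \<A>"
    and "compact (UNIV :: 't set)"
    and "radon_measure \<mu>"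
    and "A \<in> continuous_fields \<A>"
    and "B \<in> continuous_fields \<A>"
    and "synchronous_hadamard E A B"
    and "\<alpha> \<in> borel_measurable \<mu>"
    and "\<And>t. 0 \<le> \<alpha> t"
    and "integrable \<mu> \<alpha>"
  shows "(\<integral>s. \<alpha> s \<partial>\<mu>) *\<^sub>R bochner_int \<mu> (\<lambda>t. \<alpha> t *\<^sub>R hadamard E (A t) (B t))
           \<ge>\<^sub>o\<^sub>p hadamard E (bochner_int \<mu> (\<lambda>t. \<alpha> t *\<^sub>R A t)) (bochner_int \<mu> (\<lambda>s. \<alpha> s *\<^sub>R B s))"
proof -
  interpret complex_onb E
    by unfold_locales fact
  have "sets \<mu> = sets borel"
    using assms(4) by (simp add: radon_measure_def)
  have A: "continuous_on UNIV A" and B: "continuous_on UNIV B"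
    using assms(5,6) by (auto simp: continuous_fields_def)
  have Bb: "B t \<in> bounded_operators" for t
    using assms(2,6) by (auto simp: cstar_algebra_def continuous_fields_def)
  define IA where "IA = bochner_int \<mu> (\<lambda>t. \<alpha> t *\<^sub>R A t)"
  define IB where "IB = bochner_int \<mu> (\<lambda>t. \<alpha> t *\<^sub>R B t)"
  define IC where "IC = bochner_int \<mu> (\<lambda>t. \<alpha> t *\<^sub>R hadamard E (A t) (B t))"
  define I where "I = (\<integral>s. \<alpha> s \<partial>\<mu>)"
  note ex = has_bochner_int_scaleR_continuous[OF assms(3) \<open>sets \<mu> = sets borel\<close> _ assms(10)]
  have IA: "has_bochner_int \<mu> (\<lambda>t. \<alpha> t *\<^sub>R A t) IA"
    unfolding IA_def by (rule ex[OF A])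
  have IB: "has_bochner_int \<mu> (\<lambda>t. \<alpha> t *\<^sub>R B t) IB"
    unfolding IB_def by (rule ex[OF B])
  \<comment> \<open>The Hadamard products form a norm-continuous field, so the same existence result
    covers this integral.\<close>
  have IC: "has_bochner_int \<mu> (\<lambda>t. \<alpha> t *\<^sub>R hadamard E (A t) (B t)) IC"
    unfolding IC_def by (intro ex continuous_on_hadamard A B Bb)
  have IBb: "IB \<in> bounded_operators"
    using IB by (rule has_bochner_int_bounded_operators) (intro bounded_operators_scaleR Bb)
  have ICb: "IC \<in> bounded_operators"
    using IC by (rule has_bochner_int_bounded_operators) (intro bounded_operators_scaleR hadamard_in_bounded_operators Bb)
  define m where "m X j = cinner (blinfun_apply X (fst j)) (snd j)" for X :: "'h \<Rightarrow>\<^sub>L 'h" and j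
  have m: "has_bochner_integral \<mu> (\<lambda>t. \<alpha> t *\<^sub>R m (X t) j) (m Y j)"
    if "has_bochner_int \<mu> (\<lambda>t. \<alpha> t *\<^sub>R X t) Y" for X Y j
    using has_bochner_int_bounded_linear[OF bounded_linear_matrix_entry that, of "fst j" "snd j"]
    by (simp add: m_def blinfun.scaleR_left cinner_scaleR_left)
  have m_hadamard: "m (hadamard E X Y) j = m X j * m Y j"
    if "Y \<in> bounded_operators" "j \<in> E \<times> E" for X Y j
    using that unfolding m_def by (intro hadamard_apply) auto
  have m_diff: "m (X - Y) j = m X j - m Y j" for X Y j
    by (simp add: m_def blinfun.diff_left cinner.diff_left)
  have m_scaleR: "m (r *\<^sub>R X) j = r *\<^sub>R m X j" for r X j
    by (simp add: m_def blinfun.scaleR_left cinner_scaleR_left)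
  have "positive_operator (I *\<^sub>R IC - hadamard E IA IB)"
  proof (rule positive_operatorI, unfold m_def[symmetric])
    show "I *\<^sub>R IC - hadamard E IA IB \<in> bounded_operators"
      by (intro bounded_operators_diff bounded_operators_scaleR ICb hadamard_in_bounded_operators IBb)
    fix F and c :: "'h \<Rightarrow> complex" assume F: "finite F" "F \<subseteq> E"
    let ?w = "\<lambda>j. c (fst j) * cnj (c (snd j))"
    have FE: "j \<in> E \<times> E" if "j \<in> F \<times> F" for j
      using F that by auto
    have "(\<Sum>j\<in>F \<times> F. ?w j * m (I *\<^sub>R IC - hadamard E IA IB) j)
        = (\<Sum>j\<in>F \<times> F. ?w j * (I *\<^sub>R m IC j - m IA j * m IB j))"
      by (intro sum.cong refl) (simp add: m_diff m_scaleR m_hadamard[OF IBb FE])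
    also have "\<dots> \<in> \<real>\<^sub>\<ge>\<^sub>0"
    \<comment> \<open>The index set consists of the pairs from \<open>F\<close>, with the
      coefficient products \<open>?w\<close> as weights and matrix entries as scalar functions; the
      hypotheses on single integrals are entries of \<open>IA\<close>, \<open>IB\<close> and
      \<open>IC\<close>.\<close>
    proof (rule synchronous_integral_inequality[where a = "\<lambda>j t. m (A t) j" and b = "\<lambda>j t. m (B t) j"])
      show "has_bochner_integral \<mu> \<alpha> I"
        unfolding I_def by (rule has_bochner_integral_integrable[OF assms(10)])
      show "has_bochner_integral \<mu> (\<lambda>t. \<alpha> t *\<^sub>R (m (A t) j * m (B t) j)) (m IC j)"
        if "j \<in> F \<times> F" for j
        using m[OF IC, of j] by (simp add: m_hadamard[OF Bb FE[OF that]])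
      fix s t
      have "positive_operator (hadamard E (A t - A s) (B t - B s))"
        using assms(7) by (simp add: synchronous_hadamard_def operator_ge_def)
      \<comment> \<open>The synchronous property is tested on the same finite combination of basis
        vectors, with coefficients \<open>c\<close>.\<close>
      then have "(\<Sum>j\<in>F \<times> F. ?w j * m (hadamard E (A t - A s) (B t - B s)) j) \<in> \<real>\<^sub>\<ge>\<^sub>0"
        unfolding m_def by (simp add: positive_operator_def flip: cinner_apply_sum)
      also have "(\<Sum>j\<in>F \<times> F. ?w j * m (hadamard E (A t - A s) (B t - B s)) j)
          = (\<Sum>j\<in>F \<times> F. ?w j * ((m (A t) j - m (A s) j) * (m (B t) j - m (B s) j)))"
        by (intro sum.cong refl) (simp add: m_hadamard[OF bounded_operators_diff[OF Bb Bb] FE] m_diff)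
      finally show "(\<Sum>j\<in>F \<times> F. ?w j * ((m (A t) j - m (A s) j) * (m (B t) j - m (B s) j))) \<in> \<real>\<^sub>\<ge>\<^sub>0" .
    qed (rule m IA IB assms(9))+
    finally show "(\<Sum>j\<in>F \<times> F. ?w j * m (I *\<^sub>R IC - hadamard E IA IB) j) \<in> \<real>\<^sub>\<ge>\<^sub>0" .
  qed
  then show ?thesis
    by (simp add: operator_ge_def I_def IA_def IB_def IC_def)
qed

end
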